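(* Let $q$ be a complex number with $|q|<1$, and for integers $m\ge0$ let $$U_m(x)=\sum_{k=0}^m\begin{bmatrix}m+k\\k\end{bmatrix}_q\frac{x^k}{(-q;q)_k}.$$ Then for every integer $m\ge 0$ and every $x$, $$(1-q^{m+2})U_{m+2}(x)+(xq^{2m+3}-q-1)U_{m+1}(x)+q(1+q^{m+1})U_{m}(x)=(x-q)\frac{(q^{m+2};q)_m}{(q^2;q^2)_m}x^{m+1}.$$
   Context: For integers $n\ge 0$, $(x;p)_n=\prod_{i=0}^{n-1}(1-xp^i)$ (empty product equal to $1$). The $q$-binomial coefficient is $\begin{bmatrix}n\\k\end{bmatrix}_q=\frac{(q;q)_n}{(q;q)_{n-k}(q;q)_k}$. *)

theory Defs
  imports Complex_Main
begin

definition qpoch :: "complex \<Rightarrow> complex \<Rightarrow> nat \<Rightarrow> complex" where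
  "qpoch x p n = (\<Prod>i<n. 1 - x * p ^ i)"

text \<open>Meaningful only for \<open>k \<le> n\<close>, since \<open>n - k\<close> is truncated subtraction.\<close>

definition qbinom :: "complex \<Rightarrow> nat \<Rightarrow> nat \<Rightarrow> complex" where
  "qbinom q n k = qpoch q q n / (qpoch q q (n - k) * qpoch q q k)"

definition U :: "complex \<Rightarrow> nat \<Rightarrow> complex \<Rightarrow> complex" where
  "U q m x = (\<Sum>k=0..m. qbinom q (m + k) k * (x ^ k / qpoch (- q) q k))"

end

theory Submission
  imports Defs
begin

text \<open>
  Since \<open>(q;q)\<^sub>k (-q;q)\<^sub>k = (q\<^sup>2;q\<^sup>2)\<^sub>k\<close>, the coefficient of \<open>x\<^sup>k\<close> in \<open>U\<^sub>m\<close> is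
  \<open>a(m,k) = (q;q)\<^sub>m\<^sub>+\<^sub>k / ((q;q)\<^sub>m (q\<^sup>2;q\<^sup>2)\<^sub>k)\<close>, which makes sense also for \<open>k > m\<close>. Dividing by a common
  factor, the coefficientwise form of the recurrence becomes a polynomial identity in \<open>q\<close>,
  \<open>q\<^sup>m\<close> and \<open>q\<^sup>k\<close>, so that the left-hand side with all three sums cut off at \<open>k = N\<close> telescopes to
  a single monomial. The right-hand side is what remains for \<open>N = m + 1\<close> after adding the missing
  top term of \<open>U\<^sub>m\<^sub>+\<^sub>2\<close> and removing the superfluous one of \<open>U\<^sub>m\<close>.
\<close>

lemma qpoch_0 [simp]: "qpoch x p 0 = 1"
  by (simp add: qpoch_def)

lemma qpoch_Suc [simp]: "qpoch x p (Suc n) = qpoch x p n * (1 - x * p ^ n)"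
  by (simp add: qpoch_def)

lemma qpoch_add: "qpoch x p (m + n) = qpoch x p m * qpoch (x * p ^ m) p n"
  by (induction n) (simp_all add: power_add mult_ac)

lemma qpoch_mult_qpoch_uminus: "qpoch x p n * qpoch (- x) p n = qpoch (x ^ 2) (p ^ 2) n"
  by (induction n)
     (simp_all add: algebra_simps power2_eq_square power_mult_distrib flip: power_mult)

lemma one_minus_power_nonzero:
  fixes q :: "'a :: real_normed_div_algebra"
  assumes "norm q < 1" "n > 0"
  shows "1 - q ^ n \<noteq> 0"
proof
  assume "1 - q ^ n = 0"
  then have "norm q ^ n = 1"
    by (simp flip: norm_power)
  moreover have "norm q ^ n < 1"
    using assms by (simp add: power_less_one_iff)
  ultimately show False by simp
qed

lemma qpoch_self_nonzero:
  assumes "norm q < 1"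
  shows "qpoch q q n \<noteq> 0"
  using one_minus_power_nonzero[OF assms, of "Suc _"] by (induction n) auto

definition Ucoeff :: "complex \<Rightarrow> nat \<Rightarrow> nat \<Rightarrow> complex" where
  "Ucoeff q m k = qpoch q q (m + k) / (qpoch q q m * qpoch (q ^ 2) (q ^ 2) k)"

lemma U_eq_sum_Ucoeff: "U q m x = (\<Sum>k\<le>m. Ucoeff q m k * x ^ k)"
  unfolding U_def qbinom_def Ucoeff_def atMost_atLeast0
  by (simp add: mult.assoc flip: qpoch_mult_qpoch_uminus)

lemma Ucoeff_0:
  assumes "norm q < 1"
  shows "Ucoeff q m 0 = 1"
  using qpoch_self_nonzero[OF assms] by (simp add: Ucoeff_def)

lemma Ucoeff_Suc_right:
  "Ucoeff q m (Suc k) = Ucoeff q m k * (1 - q ^ Suc (m + k)) / (1 - (q ^ Suc k) ^ 2)"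
  by (simp add: Ucoeff_def power_mult_distrib flip: power_mult) (simp add: mult.commute)

lemma Ucoeff_Suc_left:
  "Ucoeff q (Suc m) k = Ucoeff q m k * (1 - q ^ Suc (m + k)) / (1 - q ^ Suc m)"
  by (simp add: Ucoeff_def)

text \<open>With \<open>A = q ^ Suc m\<close> and \<open>B = q ^ Suc k\<close>, a common factor
  \<open>t\<close> reduces the claim to \<open>(1 - A*B)*(1 - q*A*B) - (1 + q)*(1 - A*B) + q*(1 -
  A^2) + q*A^2*(1 - B^2) = 0\<close>.\<close>

lemma Ucoeff_recurrence:
  assumes "norm q < 1"
  shows "(1 - q ^ (m + 2)) * Ucoeff q (m + 2) (Suc k) - (1 + q) * Ucoeff q (m + 1) (Suc k)
       + q * (1 + q ^ (m + 1)) * Ucoeff q m (Suc k)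
       + q ^ (2 * m + 3) * Ucoeff q (m + 1) k = 0"
proof -
  \<comment> \<open>The denominators of \<open>t\<close> make three of the coefficients polynomial
    multiples of it; the remaining factor \<open>1 - q * A\<close> is supplied by the recurrence
    itself.\<close>
  define A B t where "A = q ^ Suc m" and "B = q ^ Suc k"
    and "t = Ucoeff q m k * (1 - q ^ Suc (m + k)) / ((1 - A) * (1 - B ^ 2))"
  have nz: "1 - A \<noteq> 0" "1 - q * A \<noteq> 0" "1 - B ^ 2 \<noteq> 0"
    unfolding A_def B_def power_Suc[symmetric] power_mult[symmetric]
    by (rule one_minus_power_nonzero[OF assms], simp)+
  have AB: "q ^ Suc (Suc (m + k)) = A * B" "q ^ Suc (Suc (Suc (m + k))) = q * A * B"
    by (simp_all add: A_def B_def power_add)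
  have pow: "q ^ (m + 2) = q * A" "q ^ (m + 1) = A" "q ^ (2 * m + 3) = q * A ^ 2"
    by (simp_all add: A_def power_mult_distrib numeral_3_eq_3 power2_eq_square mult_2 power_add)
  have a0: "Ucoeff q m (Suc k) = (1 - A) * t"
    using nz(1) by (simp add: Ucoeff_Suc_right t_def B_def)
  have a1: "Ucoeff q (m + 1) (Suc k) = (1 - A * B) * t"
    using nz(1) a0 AB by (simp add: Ucoeff_Suc_left A_def)
  have a2: "(1 - q * A) * Ucoeff q (m + 2) (Suc k) = (1 - A * B) * (1 - q * A * B) * t"
    using nz(2) a1 AB Ucoeff_Suc_left[of q "Suc m" "Suc k"] by (simp add: A_def)
  have a1': "Ucoeff q (m + 1) k = (1 - B ^ 2) * t"
    using nz(3) by (simp add: Ucoeff_Suc_left t_def A_def)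
  show ?thesis
    unfolding pow a0 a1 a2 a1' by algebra
qed

lemma truncated_sum_recurrence:
  assumes "norm q < 1"
  shows "(1 - q ^ (m + 2)) * (\<Sum>k\<le>N. Ucoeff q (m + 2) k * x ^ k)
       + (x * q ^ (2 * m + 3) - q - 1) * (\<Sum>k\<le>N. Ucoeff q (m + 1) k * x ^ k)
       + q * (1 + q ^ (m + 1)) * (\<Sum>k\<le>N. Ucoeff q m k * x ^ k)
       = q ^ (2 * m + 3) * Ucoeff q (m + 1) N * x ^ Suc N"
proof (induction N)
  case 0
  show ?case
    by (simp add: Ucoeff_0[OF assms] algebra_simps)
next
  case (Suc N)
  \<comment> \<open>The induction step as a pure ring identity: \<open>y\<close> stands for
    \<open>x ^ Suc N\<close>, and \<open>b\<close> for the coefficient at \<open>N\<close>, which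
    the factor \<open>x\<close> moves up one degree.\<close>
  have step: "P * (S2 + a2 * y) + (x * Q - q - 1) * (S1 + a1 * y) + R * (S0 + a0 * y)
      = Q * a1 * (x * y)"
    if "P * S2 + (x * Q - q - 1) * S1 + R * S0 = Q * b * y"
      and "P * a2 - (1 + q) * a1 + R * a0 + Q * b = 0"
    for P Q R S0 S1 S2 a0 a1 a2 b y :: complex
    using that by algebra
  show ?case
    unfolding sum.atMost_Suc power_Suc[of x "Suc N"]
    by (rule step[OF Suc.IH Ucoeff_recurrence[OF assms]])
qed

text \<open>These are the boundary coefficients for the cutoff \<open>m + 1\<close>. Splitting
  \<open>(q;q)\<close> of length \<open>2 * m + 1\<close> after \<open>m + 1\<close> factors gives
  \<open>c m\<close> at \<open>(m + 1, m)\<close>; one-step ratios carry this value to the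
  others.\<close>

lemma Ucoeff_diagonal:
  assumes "norm q < 1"
  defines "c m \<equiv> qpoch (q ^ (m + 2)) q m / qpoch (q ^ 2) (q ^ 2) m"
  shows "Ucoeff q m (m + 1) * (1 + q ^ (m + 1)) = c m"
    and "Ucoeff q (m + 1) (m + 1) = c m"
    and "(1 - q ^ (m + 2)) * Ucoeff q (m + 2) (m + 2) = c m * (1 - q ^ (2 * m + 3))"
proof -
  have nz: "1 - q ^ n \<noteq> 0" if "n > 0" for n
    using one_minus_power_nonzero[OF assms(1) that] .
  have factor: "1 - (q ^ n) ^ 2 = (1 - q ^ n) * (1 + q ^ n)" for n
    by (simp add: algebra_simps power2_eq_square)
  have nz': "1 + q ^ n \<noteq> 0" if "n > 0" for n
    using nz[of "n * 2"] that factor[of n] by (auto simp: power_mult)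
  define A where "A = q ^ Suc m"
  have pow: "q ^ Suc (Suc m) = q * A" "q ^ Suc m = A"
    "q ^ Suc (m + Suc m) = A ^ 2" "q ^ (2 * m + 3) = q * A ^ 2"
    "q ^ Suc (Suc m + Suc m) = q * A ^ 2"
    "q ^ Suc (Suc (Suc m) + Suc m) = (q * A) ^ 2"
    by (simp_all add: A_def power_mult_distrib numeral_3_eq_3 power2_eq_square mult_2 power_add)
  have nzA: "1 - A \<noteq> 0" "1 + A \<noteq> 0" "1 - q * A \<noteq> 0" "1 + q * A \<noteq> 0"
    using nz[of "Suc m"] nz'[of "Suc m"] nz[of "Suc (Suc m)"] nz'[of "Suc (Suc m)"]
    by (simp_all add: A_def)
  have fac: "1 - A ^ 2 = (1 - A) * (1 + A)" "1 - (q * A) ^ 2 = (1 - q * A) * (1 + q * A)"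
    by algebra+
  have "qpoch q q (Suc m + m) = qpoch q q (Suc m) * qpoch (q ^ (m + 2)) q m"
    by (simp only: qpoch_add) simp
  then have "Ucoeff q (Suc m) m = c m"
    using qpoch_self_nonzero[OF assms(1), of "Suc m"]
    by (simp add: Ucoeff_def c_def del: qpoch_Suc)
  \<comment> \<open>The factor \<open>1 - q ^ Suc (m + m)\<close> stays on the left, since it is
    also the numerator of the ratio used next.\<close>
  then have 0: "Ucoeff q m m * (1 - q ^ Suc (m + m)) = (1 - A) * c m"
    using Ucoeff_Suc_left[of q m m] nzA by (simp add: A_def field_simps)
  have 1: "Ucoeff q m (Suc m) = c m / (1 + A)"
    unfolding Ucoeff_Suc_right 0 pow fac using nzA by simp
  then show "Ucoeff q m (m + 1) * (1 + q ^ (m + 1)) = c m"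
    using nzA pow by simp
  have 2: "Ucoeff q (Suc m) (Suc m) = c m"
    unfolding Ucoeff_Suc_left 1 pow fac using nzA by simp
  then show "Ucoeff q (m + 1) (m + 1) = c m"
    by simp
  have 3: "(1 - q * A) * Ucoeff q (Suc (Suc m)) (Suc m) = c m * (1 - q * A ^ 2)"
    unfolding Ucoeff_Suc_left[of q "Suc m"] 2 pow using nzA by simp
  \<comment> \<open>Numerator and denominator of this ratio are both \<open>1 - (q * A) ^ 2\<close>,
    so the value from \<open>3\<close> carries over unchanged.\<close>
  have "(1 - q * A) * Ucoeff q (Suc (Suc m)) (Suc (Suc m)) = c m * (1 - q * A ^ 2)"
    unfolding Ucoeff_Suc_right[of q "Suc (Suc m)" "Suc m"] pow
    using nzA 3 fac by simp
  then show "(1 - q ^ (m + 2)) * Ucoeff q (m + 2) (m + 2) = c m * (1 - q ^ (2 * m + 3))"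
    using pow by simp
qed

theorem theorem3p4:
  fixes q x :: complex and m :: nat
  assumes "norm q < 1"
  shows "(1 - q ^ (m + 2)) * U q (m + 2) x
       + (x * q ^ (2 * m + 3) - q - 1) * U q (m + 1) x
       + q * (1 + q ^ (m + 1)) * U q m x
       = (x - q) * (qpoch (q ^ (m + 2)) q m / qpoch (q ^ 2) (q ^ 2) m) * x ^ (m + 1)"
proof -
  define c where "c = qpoch (q ^ (m + 2)) q m / qpoch (q ^ 2) (q ^ 2) m"
  note diag = Ucoeff_diagonal[OF assms, of m, folded c_def]
  have U0: "U q m x = (\<Sum>k\<le>m + 1. Ucoeff q m k * x ^ k) - Ucoeff q m (m + 1) * x ^ (m + 1)"
    and U2: "U q (m + 2) x = (\<Sum>k\<le>m + 1. Ucoeff q (m + 2) k * x ^ k)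
      + Ucoeff q (m + 2) (m + 2) * x ^ (m + 2)"
    by (simp_all add: U_eq_sum_Ucoeff)
  have "(1 - q ^ (m + 2)) * U q (m + 2) x + (x * q ^ (2 * m + 3) - q - 1) * U q (m + 1) x
      + q * (1 + q ^ (m + 1)) * U q m x
    = q ^ (2 * m + 3) * Ucoeff q (m + 1) (m + 1) * x ^ Suc (m + 1)
      + (1 - q ^ (m + 2)) * Ucoeff q (m + 2) (m + 2) * x ^ (m + 2)
      - q * (Ucoeff q m (m + 1) * (1 + q ^ (m + 1))) * x ^ (m + 1)"
    unfolding U0 U2 U_eq_sum_Ucoeff[of q "m + 1" x]
      truncated_sum_recurrence[OF assms, of m x "m + 1", symmetric]
    by (simp only: ring_distribs mult.assoc mult.left_commute mult.commute) simp
  \<comment> \<open>The two contributions \<open>q ^ (2 * m + 3) * c\<close> in degree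
    \<open>m + 2\<close> cancel.\<close>
  also have "\<dots> = (x - q) * c * x ^ (m + 1)"
    unfolding diag by (simp add: algebra_simps)
  finally show ?thesis
    unfolding c_def .
qed

end
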